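(* Let $\theta$ be a stationary function of $\mathcal E$ for the fixed-boundary (Dirichlet) problem, such that $\theta'$ does not vanish identically on $[a,b]$. Assume that one of the following two alternatives holds: either there is $k>0$ such that $\delta^2\mathcal E_\theta[\tau]\ge k\int_a^b\tau^2\,ds$ for all $\tau\in\mathcal C^D([a,b])$, or there is $\tau\in\mathcal C^D([a,b])$ with $\delta^2\mathcal E_\theta[\tau]<0$. Let $\gamma:[a,b]\to\mathbb R^2$, $\gamma(s)=(\theta(s),\theta'(s))$, be the associated phase-plane trajectory and let $I[\gamma]=\#\{s\in[a,b]:\theta'(s)=0\}$. Then: (1) if $I[\gamma]\ge 2$, then $\theta$ is not locally minimal for $\mathcal E$ on $\mathcal D^D([a,b])$; (2) if $I[\gamma]=0$, then $\theta$ is locally minimal for $\mathcal E$ on $\mathcal D^D([a,b])$.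
   Context: Let $a<b$ be real numbers, $A\in\mathbb R$, and let $V:\mathbb R\to\mathbb R$ be of class $C^2$ such that $V_\theta=dV/d\theta$ and $V_{\theta\theta}=d^2V/d\theta^2$ have no common zero. For $\theta\in C^1([a,b])$ set $\mathcal E[\theta]=\int_a^b\left(\frac{(\theta'(s)-A)^2}{2}-V(\theta(s))\right)ds$. Fixed boundaries: $\theta(a)=T_a$ and $\theta(b)=T_b$ are prescribed. Let $\mathcal C^D([a,b])=\{\tau\in C^1([a,b]):\tau(a)=\tau(b)=0\}\setminus\{0\}$ and $\mathcal D^D([a,b])=\{\tau\in C^2([a,b])\setminus\{0\}:\tau(a)=\tau(b)=0\}$. $\theta$ is stationary if $\frac{d}{d\epsilon}\mathcal E[\theta+\epsilon\tau]|_{\epsilon=0}=0$ for all $\tau\in\mathcal C^D([a,b])$; equivalently, $\theta$ is a $C^2$ solution of $\theta''(s)+V_\theta(\theta(s))=0$ on $[a,b]$ with $\theta(a)=T_a$, $\theta(b)=T_b$. The second variation is $\delta^2\mathcal E_\theta[\tau]=\frac{d^2}{d\epsilon^2}\mathcal E[\theta+\epsilon\tau]|_{\epsilon=0}=\int_a^b \left((\tau')^2-V_{\theta\theta}(\theta(s))\tau^2\right)ds$. $\theta$ is locally minimal for $\mathcal E$ on a set $\mathcal P$ of perturbations if for every $\tau\in\mathcal P$ there exists $M>0$ such that $\mathcal E[\theta+\epsilon\tau]>\mathcal E[\theta]$ for all $\epsilon\in[-M,M]\setminus\{0\}$. *)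

theory Defs
  imports "HOL-Analysis.Analysis" "HOL-Library.Extended_Nat"
begin

text \<open>
  A function on \<open>[a,b]\<close> is represented by a total function \<open>real \<Rightarrow> real\<close> whose values outside
  \<open>{a..b}\<close> are never looked at. Accordingly, derivatives on \<open>{a..b}\<close> are taken within \<open>{a..b}\<close>
  (one-sided at the endpoints), and \<open>\<tau> \<noteq> 0\<close> means that \<open>\<tau>\<close> does not vanish identically on
  \<open>{a..b}\<close>.
\<close>

primrec Ck_on :: "nat \<Rightarrow> real set \<Rightarrow> (real \<Rightarrow> real) \<Rightarrow> bool" where
  "Ck_on 0 S f \<longleftrightarrow> continuous_on S f"
| "Ck_on (Suc k) S f \<longleftrightarrow>
     (\<exists>g. (\<forall>s\<in>S. (f has_real_derivative g s) (at s within S)) \<and> Ck_on k S g)"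

definition deriv_ivl :: "real \<Rightarrow> real \<Rightarrow> (real \<Rightarrow> real) \<Rightarrow> real \<Rightarrow> real" where
  "deriv_ivl a b f s = vector_derivative f (at s within {a..b})"

definition energy ::
  "real \<Rightarrow> real \<Rightarrow> real \<Rightarrow> (real \<Rightarrow> real) \<Rightarrow> (real \<Rightarrow> real) \<Rightarrow> real" where
  "energy a b A V \<theta> =
     integral {a..b} (\<lambda>s. (deriv_ivl a b \<theta> s - A)\<^sup>2 / 2 - V (\<theta> s))"

definition C_D :: "real \<Rightarrow> real \<Rightarrow> (real \<Rightarrow> real) set" where
  "C_D a b = {\<tau>. Ck_on 1 {a..b} \<tau> \<and> \<tau> a = 0 \<and> \<tau> b = 0 \<and> (\<exists>s\<in>{a..b}. \<tau> s \<noteq> 0)}"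

definition D_D :: "real \<Rightarrow> real \<Rightarrow> (real \<Rightarrow> real) set" where
  "D_D a b = {\<tau>. Ck_on 2 {a..b} \<tau> \<and> \<tau> a = 0 \<and> \<tau> b = 0 \<and> (\<exists>s\<in>{a..b}. \<tau> s \<noteq> 0)}"

definition stationary_D ::
  "real \<Rightarrow> real \<Rightarrow> real \<Rightarrow> (real \<Rightarrow> real) \<Rightarrow> real \<Rightarrow> real \<Rightarrow> (real \<Rightarrow> real) \<Rightarrow> bool" where
  "stationary_D a b A V Ta Tb \<theta> \<longleftrightarrow>
     Ck_on 1 {a..b} \<theta> \<and> \<theta> a = Ta \<and> \<theta> b = Tb \<and>
     (\<forall>\<tau>\<in>C_D a b.
        ((\<lambda>\<epsilon>. energy a b A V (\<lambda>s. \<theta> s + \<epsilon> * \<tau> s)) has_real_derivative 0) (at 0))"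

definition second_variation ::
  "real \<Rightarrow> real \<Rightarrow> real \<Rightarrow> (real \<Rightarrow> real) \<Rightarrow> (real \<Rightarrow> real) \<Rightarrow> (real \<Rightarrow> real) \<Rightarrow> real" where
  "second_variation a b A V \<theta> \<tau> =
     deriv (deriv (\<lambda>\<epsilon>. energy a b A V (\<lambda>s. \<theta> s + \<epsilon> * \<tau> s))) 0"

definition locally_minimal_on ::
  "real \<Rightarrow> real \<Rightarrow> real \<Rightarrow> (real \<Rightarrow> real) \<Rightarrow> (real \<Rightarrow> real) \<Rightarrow> (real \<Rightarrow> real) set \<Rightarrow> bool" where
  "locally_minimal_on a b A V \<theta> P \<longleftrightarrow>
     (\<forall>\<tau>\<in>P. \<exists>M>0. \<forall>\<epsilon>\<in>{-M..M} - {0}.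
        energy a b A V (\<lambda>s. \<theta> s + \<epsilon> * \<tau> s) > energy a b A V \<theta>)"

definition phase_trajectory ::
  "real \<Rightarrow> real \<Rightarrow> (real \<Rightarrow> real) \<Rightarrow> real \<Rightarrow> real \<times> real" where
  "phase_trajectory a b \<theta> s = (\<theta> s, deriv_ivl a b \<theta> s)"

text \<open>The count is extended-valued because \<^const>\<open>card\<close> would give 0 on an infinite set.\<close>

definition axis_hits :: "real \<Rightarrow> real \<Rightarrow> (real \<Rightarrow> real \<times> real) \<Rightarrow> enat" where
  "axis_hits a b \<gamma> =
     (let Z = {s\<in>{a..b}. snd (\<gamma> s) = 0} in if finite Z then enat (card Z) else \<infinity>)"

end

theory Submission
  imports Defs
begin

text \<open>
  Write \<open>u = \<theta>'\<close> and \<open>q s = V''(\<theta> s)\<close>. By du Bois-Reymond's lemma a stationary \<open>\<theta>\<close> solves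
  \<open>\<theta>'' = - V'(\<theta>)\<close>, so \<open>u\<close> solves the Jacobi equation \<open>u'' = - q u\<close> of the second variation
  \<open>Q \<tau> = \<integral> \<tau>'\<^sup>2 - q \<tau>\<^sup>2\<close>. Substituting \<open>\<tau> = u H\<close> turns \<open>Q\<close> into a square: whenever \<open>u H\<close> vanishes at both
  ends, \<open>Q (u H) = \<integral> (u H')\<^sup>2\<close> (lemma \<open>Jacobi_identity\<close>). Both parts rest on this identity.

  If \<open>u\<close> has no zero, every \<open>\<tau>\<close> is of the form \<open>u H\<close>, so \<open>Q \<ge> 0\<close>. This excludes the second alternative;
  the first one gives \<open>Q \<tau> > 0\<close> for every \<open>\<tau> \<noteq> 0\<close>, and the energy, which has a critical point at
  \<open>\<epsilon> = 0\<close> along \<open>\<tau>\<close>, has a strict local minimum there.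

  If \<open>u\<close> has two zeros \<open>c < d\<close>, restricting \<open>u\<close> to \<open>[c,d]\<close> and extending it by \<open>0\<close> would give \<open>Q = 0\<close>, but the
  result has corners. The corners are removed by taking \<open>u H\<close> with \<open>H = u\<^sup>2 / (u\<^sup>2 + e)\<close>: this is \<open>C\<^sup>1\<close> after
  extension by zero, and \<open>Q (u H) = \<integral> (u H')\<^sup>2\<close> tends to \<open>0\<close> as \<open>e\<close> does, by dominated convergence, while
  \<open>\<integral> (u H)\<^sup>2\<close> stays bounded below (lemma \<open>two_zeros_not_coercive\<close>). Uniqueness for the Jacobi equation
  ensures that \<open>u\<close> is not identically zero on \<open>[c,d]\<close>. This excludes the first alternative, so \<open>Q \<tau> < 0\<close> for
  some \<open>C\<^sup>1\<close> perturbation \<open>\<tau>\<close>. Approximating \<open>\<tau>'\<close> uniformly by polynomials gives a \<open>C\<^sup>2\<close> perturbation with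
  \<open>Q < 0\<close>, along which the energy has a strict local maximum at \<open>\<epsilon> = 0\<close>.
\<close>

section \<open>Functions of class C1 on an interval\<close>

text \<open>
  \<open>f\<close> is of class \<open>C\<^sup>1\<close> on \<open>S\<close> with derivative \<open>f'\<close>. The derivative is an explicit argument, taken within \<open>S\<close>;
  outside \<open>S\<close> both functions are arbitrary.
\<close>

definition C1_deriv_on :: "real set \<Rightarrow> (real \<Rightarrow> real) \<Rightarrow> (real \<Rightarrow> real) \<Rightarrow> bool" where
  "C1_deriv_on S f f' \<longleftrightarrow>
     (\<forall>s\<in>S. (f has_real_derivative f' s) (at s within S)) \<and> continuous_on S f'"

lemma Ck_on_1_iff: "Ck_on 1 S f \<longleftrightarrow> (\<exists>f'. C1_deriv_on S f f')"
  by (simp add: C1_deriv_on_def)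

lemma Ck_on_2_iff: "Ck_on 2 S f \<longleftrightarrow> (\<exists>f' f''. (\<forall>s\<in>S. (f has_real_derivative f' s) (at s within S)) \<and> C1_deriv_on S f' f'')"
  by (auto simp add: C1_deriv_on_def numeral_2_eq_2)

lemma C1_deriv_onD:
  assumes "C1_deriv_on S f f'"
  shows "s \<in> S \<Longrightarrow> (f has_real_derivative f' s) (at s within S)"
    and "continuous_on S f'" "continuous_on S f"
  using assms DERIV_continuous_on unfolding C1_deriv_on_def by blast+

lemma deriv_ivl_eq:
  assumes "a < b" "s \<in> {a..b}" "(f has_real_derivative d) (at s within {a..b})"
  shows "deriv_ivl a b f s = d"
  using assms unfolding deriv_ivl_def
  by (simp add: vector_derivative_within_closed_interval has_real_derivative_iff_has_vector_derivative)

lemma D_D_subset_C_D: "D_D a b \<subseteq> C_D a b"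
proof -
  have "Ck_on 1 {a..b} f" if "Ck_on 2 {a..b} f" for f
    using that C1_deriv_onD(3) unfolding Ck_on_2_iff Ck_on_1_iff
    by (metis C1_deriv_on_def)
  then show ?thesis unfolding D_D_def C_D_def by blast
qed

lemma C1_deriv_on_zero:
  assumes "a < b" "C1_deriv_on {a..b} f f'" "\<And>s. s \<in> {a..b} \<Longrightarrow> f s = 0" "s \<in> {a..b}"
  shows "f' s = 0"
proof -
  have "(f has_real_derivative 0) (at s within {a..b})"
    by (rule has_field_derivative_transform_within[OF DERIV_const zero_less_one]) (use assms in auto)
  then show ?thesis using deriv_ivl_eq assms C1_deriv_onD(1)[OF assms(2)] by metis
qed

section \<open>Derivatives of the energy along a perturbation\<close>

lemma energy_eq:
  assumes "a < b" "\<And>s. s \<in> {a..b} \<Longrightarrow> (\<theta> has_real_derivative g s) (at s within {a..b})"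
  shows "energy a b A V \<theta> = integral {a..b} (\<lambda>s. (g s - A)\<^sup>2 / 2 - V (\<theta> s))"
  unfolding energy_def using deriv_ivl_eq[OF assms(1) _ assms(2)] by (intro integral_cong) simp

lemma energy_has_derivative:
  fixes V V1 :: "real \<Rightarrow> real"
  assumes ab: "a < b" and V: "\<And>x. (V has_real_derivative V1 x) (at x)" and cV1: "continuous_on UNIV V1"
    and \<theta>: "C1_deriv_on {a..b} \<theta> g" and \<tau>: "C1_deriv_on {a..b} \<tau> h"
  shows "((\<lambda>\<epsilon>. energy a b A V (\<lambda>s. \<theta> s + \<epsilon> * \<tau> s)) has_real_derivative
      integral {a..b} (\<lambda>s. (g s + \<epsilon> * h s - A) * h s - V1 (\<theta> s + \<epsilon> * \<tau> s) * \<tau> s)) (at \<epsilon>)"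
proof -
  note c [continuous_intros] = C1_deriv_onD(2,3)[OF \<theta>] C1_deriv_onD(2,3)[OF \<tau>]
  note c2 [continuous_intros] = c[THEN continuous_on_compose2, OF continuous_on_snd]
  have cV: "continuous_on UNIV V" using V by (meson DERIV_continuous_on has_field_derivative_at_within)
  note [continuous_intros] = cV1[THEN continuous_on_compose2] cV[THEN continuous_on_compose2]
  have eq: "energy a b A V (\<lambda>s. \<theta> s + e * \<tau> s)
      = integral {a..b} (\<lambda>s. (g s + e * h s - A)\<^sup>2 / 2 - V (\<theta> s + e * \<tau> s))" for e
    by (rule energy_eq[OF ab]) (auto intro!: derivative_eq_intros C1_deriv_onD(1)[OF \<theta>] C1_deriv_onD(1)[OF \<tau>])
  have "((\<lambda>e. integral (cbox a b) (\<lambda>s. (g s + e * h s - A)\<^sup>2 / 2 - V (\<theta> s + e * \<tau> s)))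
     has_field_derivative integral (cbox a b) (\<lambda>s. (g s + \<epsilon> * h s - A) * h s - V1 (\<theta> s + \<epsilon> * \<tau> s) * \<tau> s))
     (at \<epsilon> within UNIV)"
  proof (rule leibniz_rule_field_derivative)
    show "((\<lambda>x. (g t + x * h t - A)\<^sup>2 / 2 - V (\<theta> t + x * \<tau> t)) has_field_derivative
            (g t + x * h t - A) * h t - V1 (\<theta> t + x * \<tau> t) * \<tau> t) (at x within UNIV)" for x t
      by (auto intro!: derivative_eq_intros DERIV_chain2[OF V])
    show "(\<lambda>s. (g s + x * h s - A)\<^sup>2 / 2 - V (\<theta> s + x * \<tau> s)) integrable_on cbox a b" for x
      by (intro integrable_continuous) (auto intro!: continuous_intros)
    show "continuous_on (UNIV \<times> cbox a b) (\<lambda>(x, t). (g t + x * h t - A) * h t - V1 (\<theta> t + x * \<tau> t) * \<tau> t)"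
      unfolding split_beta by (auto intro!: continuous_intros)
  qed auto
  then show ?thesis by (simp add: eq)
qed

lemma energy_has_second_derivative:
  fixes V1 V2 :: "real \<Rightarrow> real"
  assumes V1: "\<And>x. (V1 has_real_derivative V2 x) (at x)" and cV2: "continuous_on UNIV V2"
    and \<theta>: "C1_deriv_on {a..b} \<theta> g" and \<tau>: "C1_deriv_on {a..b} \<tau> h"
  shows "((\<lambda>\<epsilon>. integral {a..b} (\<lambda>s. (g s + \<epsilon> * h s - A) * h s - V1 (\<theta> s + \<epsilon> * \<tau> s) * \<tau> s))
     has_real_derivative
      integral {a..b} (\<lambda>s. (h s)\<^sup>2 - V2 (\<theta> s + \<epsilon> * \<tau> s) * (\<tau> s)\<^sup>2)) (at \<epsilon>)"
proof -
  note c [continuous_intros] = C1_deriv_onD(2,3)[OF \<theta>] C1_deriv_onD(2,3)[OF \<tau>]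
  note c2 [continuous_intros] = c[THEN continuous_on_compose2, OF continuous_on_snd]
  have cV1: "continuous_on UNIV V1" using V1 by (meson DERIV_continuous_on has_field_derivative_at_within)
  note [continuous_intros] = cV1[THEN continuous_on_compose2] cV2[THEN continuous_on_compose2]
  have "((\<lambda>e. integral (cbox a b) (\<lambda>s. (g s + e * h s - A) * h s - V1 (\<theta> s + e * \<tau> s) * \<tau> s))
     has_field_derivative integral (cbox a b) (\<lambda>s. (h s)\<^sup>2 - V2 (\<theta> s + \<epsilon> * \<tau> s) * (\<tau> s)\<^sup>2))
     (at \<epsilon> within UNIV)"
  proof (rule leibniz_rule_field_derivative)
    show "((\<lambda>x. (g t + x * h t - A) * h t - V1 (\<theta> t + x * \<tau> t) * \<tau> t) has_field_derivative
            (h t)\<^sup>2 - V2 (\<theta> t + x * \<tau> t) * (\<tau> t)\<^sup>2) (at x within UNIV)" for x t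
      by (auto intro!: derivative_eq_intros DERIV_chain2[OF V1] simp: power2_eq_square)
    show "(\<lambda>s. (g s + x * h s - A) * h s - V1 (\<theta> s + x * \<tau> s) * \<tau> s) integrable_on cbox a b" for x
      by (intro integrable_continuous) (auto intro!: continuous_intros)
    show "continuous_on (UNIV \<times> cbox a b) (\<lambda>(x, t). (h t)\<^sup>2 - V2 (\<theta> t + x * \<tau> t) * (\<tau> t)\<^sup>2)"
      unfolding split_beta by (auto intro!: continuous_intros)
  qed auto
  then show ?thesis by simp
qed

lemma strict_local_min_second_derivative:
  fixes f f' :: "real \<Rightarrow> real"
  assumes f: "\<And>x. (f has_real_derivative f' x) (at x)" and z: "f' 0 = 0"
    and f': "(f' has_real_derivative l) (at 0)" and l: "l > 0"
  shows "\<exists>M>0. \<forall>e\<in>{-M..M} - {0}. f e > f 0"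
proof -
  obtain d where d: "d > 0" "\<And>h. 0 < h \<Longrightarrow> h < d \<Longrightarrow> 0 < f' h"
    using DERIV_pos_inc_right[OF f' l] z by auto
  obtain d' where d': "d' > 0" "\<And>h. 0 < h \<Longrightarrow> h < d' \<Longrightarrow> f' (-h) < 0"
    using DERIV_pos_inc_left[OF f' l] z by auto
  define M where "M = min d d' / 2"
  have M: "M > 0" "M < d" "M < d'" using d(1) d'(1) by (auto simp: M_def)
  have cont: "continuous_on X f" for X
    using f by (intro continuous_at_imp_continuous_on ballI DERIV_isCont)
  have "f e > f 0" if "e \<in> {-M..M} - {0}" for e
  proof (cases "e > 0")
    case True
    show ?thesis
    proof (rule DERIV_pos_imp_increasing_open[OF True _ cont])
      fix x assume "0 < x" "x < e"
      with that M have "0 < f' x" by (intro d(2)) auto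
      with f show "\<exists>y. DERIV f x :> y \<and> y > 0" by blast
    qed
  next
    case False
    with that have "e < 0" by simp
    then show ?thesis
    proof (rule DERIV_neg_imp_decreasing_open[OF _ _ cont])
      fix x assume "e < x" "x < 0"
      with that M have "f' (- (- x)) < 0" by (intro d'(2)) auto
      with f show "\<exists>y. DERIV f x :> y \<and> y < 0" by auto
    qed
  qed
  with M(1) show ?thesis by blast
qed

section \<open>The Euler-Lagrange and Jacobi equations\<close>

text \<open>
  The weak equation \<open>\<integral> g \<tau>' - w \<tau> = 0\<close> for all admissible \<open>\<tau>\<close> makes \<open>g\<close> differentiable with \<open>g' = - w\<close>.
  With \<open>W\<close> a primitive of \<open>w\<close> and \<open>c\<close> the mean of \<open>m = g + W\<close>, the test function \<open>\<integral>\<^sub>a (m - c)\<close> yields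
  \<open>\<integral> (m - c)\<^sup>2 = 0\<close>.
\<close>

lemma du_Bois_Reymond:
  fixes g w :: "real \<Rightarrow> real"
  assumes ab: "a < b" and g: "continuous_on {a..b} g" and w: "continuous_on {a..b} w"
    and weak: "\<And>\<tau> h. C1_deriv_on {a..b} \<tau> h \<Longrightarrow> \<tau> a = 0 \<Longrightarrow> \<tau> b = 0 \<Longrightarrow>
        integral {a..b} (\<lambda>s. g s * h s - w s * \<tau> s) = 0"
  shows "\<forall>s\<in>{a..b}. (g has_real_derivative - w s) (at s within {a..b})"
proof -
  define W where "W = (\<lambda>s. integral {a..s} w)"
  have W: "(W has_real_derivative w s) (at s within {a..b})" if "s \<in> {a..b}" for s
    unfolding W_def using integral_has_real_derivative[OF w that] .
  have cW: "continuous_on {a..b} W" using W by (rule DERIV_continuous_on)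
  define m where "m = (\<lambda>s. g s + W s)"
  define c where "c = integral {a..b} m / (b - a)"
  define \<tau> where "\<tau> = (\<lambda>s. integral {a..s} (\<lambda>t. m t - c))"
  have cm: "continuous_on {a..b} m" unfolding m_def using g cW by (intro continuous_intros)
  have d\<tau>: "C1_deriv_on {a..b} \<tau> (\<lambda>s. m s - c)"
    unfolding C1_deriv_on_def \<tau>_def
    using cm by (auto intro!: integral_has_real_derivative continuous_intros)
  have \<tau>a: "\<tau> a = 0" by (simp add: \<tau>_def)
  have \<tau>b: "\<tau> b = 0" using ab cm
    by (simp add: \<tau>_def c_def integral_diff integrable_continuous_interval)
  have z: "integral {a..b} (\<lambda>s. g s * (m s - c) - w s * \<tau> s) = 0"
    by (rule weak[OF d\<tau> \<tau>a \<tau>b])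
  have c\<tau>: "continuous_on {a..b} \<tau>" using C1_deriv_onD(3)[OF d\<tau>] .
  have "((\<lambda>s. W s * (m s - c) + w s * \<tau> s) has_integral (W b * \<tau> b - W a * \<tau> a)) {a..b}"
    using ab by (intro fundamental_theorem_of_calculus)
     (auto intro!: derivative_eq_intros W C1_deriv_onD(1)[OF d\<tau>]
       simp: has_real_derivative_iff_has_vector_derivative[symmetric])
  moreover have "((\<lambda>s. g s * (m s - c) - w s * \<tau> s) has_integral 0) {a..b}"
    unfolding z[symmetric] using g w cm c\<tau>
    by (intro integrable_integral integrable_continuous_interval continuous_intros)
  moreover have "((\<lambda>s. c * (m s - c)) has_integral c * (\<tau> b - \<tau> a)) {a..b}"
    using ab by (intro has_integral_mult_right fundamental_theorem_of_calculus)
     (auto intro!: C1_deriv_onD(1)[OF d\<tau>] simp: has_real_derivative_iff_has_vector_derivative[symmetric])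
  ultimately have "((\<lambda>s. (W s * (m s - c) + w s * \<tau> s) + (g s * (m s - c) - w s * \<tau> s) - c * (m s - c))
      has_integral 0 + 0 - 0) {a..b}"
    unfolding \<tau>a \<tau>b by (intro has_integral_add has_integral_diff) auto
  then have "((\<lambda>s. (m s - c)\<^sup>2) has_integral 0) {a..b}"
    by (simp add: m_def algebra_simps power2_eq_square)
  then have mc: "m s = c" if "s \<in> {a..b}" for s
  proof -
    have "continuous_on {a..b} (\<lambda>s. (m s - c)\<^sup>2)" using cm by (intro continuous_intros)
    moreover have "integral {a..b} (\<lambda>s. (m s - c)\<^sup>2) = 0"
      using \<open>((\<lambda>s. (m s - c)\<^sup>2) has_integral 0) {a..b}\<close> by (rule integral_unique)
    ultimately show ?thesis
      using integral_eq_0_iff[of a b "\<lambda>s. (m s - c)\<^sup>2"] ab that by simp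
  qed
  have "(g has_real_derivative - w s) (at s within {a..b})" if s: "s \<in> {a..b}" for s
  proof (rule has_field_derivative_transform_within[OF _ zero_less_one s])
    show "((\<lambda>s. c - W s) has_real_derivative - w s) (at s within {a..b})"
      by (auto intro!: derivative_eq_intros W s)
    show "c - W t = g t" if "t \<in> {a..b}" for t
      using mc[OF that] by (simp add: m_def)
  qed
  then show ?thesis by blast
qed

text \<open>
  For a solution \<open>u\<close> of \<open>u'' = - q u\<close>, the integrand of the quadratic form at \<open>u h\<close> is
  \<open>(u u' h\<^sup>2)' + (u h')\<^sup>2\<close>. The boundary condition is on the product \<open>u h\<close>, so that it holds both when
  \<open>u\<close> vanishes at an endpoint and when \<open>h\<close> does.
\<close>

lemma Jacobi_identity:
  fixes u u' h h' q :: "real \<Rightarrow> real"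
  assumes cd: "c \<le> d"
    and u: "\<And>s. s \<in> {c..d} \<Longrightarrow> (u has_real_derivative u' s) (at s within {c..d})"
    and u': "\<And>s. s \<in> {c..d} \<Longrightarrow> (u' has_real_derivative - (q s * u s)) (at s within {c..d})"
    and h: "C1_deriv_on {c..d} h h'"
    and bd: "u c * h c = 0" "u d * h d = 0"
  shows "((\<lambda>s. (u' s * h s + u s * h' s)\<^sup>2 - q s * (u s * h s)\<^sup>2) has_integral
      integral {c..d} (\<lambda>s. (u s * h' s)\<^sup>2)) {c..d}"
proof -
  have A: "((\<lambda>s. (u' s * h s)\<^sup>2 - q s * (u s * h s)\<^sup>2 + 2 * (u s * u' s * h s * h' s)) has_integral
      (u d * u' d * (h d)\<^sup>2 - u c * u' c * (h c)\<^sup>2)) {c..d}"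
    using cd by (intro fundamental_theorem_of_calculus)
      (auto intro!: derivative_eq_intros u u' C1_deriv_onD(1)[OF h]
        simp: has_real_derivative_iff_has_vector_derivative[symmetric] algebra_simps power2_eq_square)
  have Z: "u d * u' d * (h d)\<^sup>2 - u c * u' c * (h c)\<^sup>2 = 0"
    using bd by auto
  have B: "((\<lambda>s. (u s * h' s)\<^sup>2) has_integral integral {c..d} (\<lambda>s. (u s * h' s)\<^sup>2)) {c..d}"
    using DERIV_continuous_on[OF u] C1_deriv_onD(2)[OF h]
    by (intro integrable_integral integrable_continuous_interval continuous_intros) auto
  show ?thesis
    using has_integral_add[OF A[unfolded Z] B]
    by (simp add: algebra_simps power2_eq_square)
qed

text \<open>
  A Gronwall argument: \<open>y = u\<^sup>2 + u'\<^sup>2\<close> satisfies \<open>\<bar>y'\<bar> \<le> L y\<close> for a constant \<open>L\<close>, so that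
  \<open>y exp (- L t)\<close> is nonincreasing and \<open>y exp (L t)\<close> is nondecreasing.
\<close>

lemma linear_ode_unique:
  fixes u u' q :: "real \<Rightarrow> real"
  assumes u: "\<And>s. s \<in> {a..b} \<Longrightarrow> (u has_real_derivative u' s) (at s within {a..b})"
    and u': "\<And>s. s \<in> {a..b} \<Longrightarrow> (u' has_real_derivative - (q s * u s)) (at s within {a..b})"
    and q: "continuous_on {a..b} q"
    and z: "s0 \<in> {a..b}" "u s0 = 0" "u' s0 = 0"
    and s: "s \<in> {a..b}"
  shows "u s = 0"
proof -
  obtain K where K: "\<And>t. t \<in> {a..b} \<Longrightarrow> \<bar>q t\<bar> \<le> K"
    using compact_imp_bounded[OF compact_continuous_image[OF q compact_Icc]]
    unfolding bounded_iff by (metis imageI real_norm_def)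
  define y where "y = (\<lambda>t. (u t)\<^sup>2 + (u' t)\<^sup>2)"
  define y' where "y' = (\<lambda>t. 2 * u t * u' t * (1 - q t))"
  have dy: "(y has_real_derivative y' t) (at t within {a..b})" if "t \<in> {a..b}" for t
    unfolding y_def y'_def
    by (auto intro!: derivative_eq_intros u[OF that] u'[OF that] simp: algebra_simps)
  have cy: "continuous_on {a..b} y" using dy by (rule DERIV_continuous_on)
  have by': "\<bar>y' t\<bar> \<le> (1 + K) * y t" if "t \<in> {a..b}" for t
  proof -
    have "0 \<le> (\<bar>u t\<bar> - \<bar>u' t\<bar>)\<^sup>2" by simp
    then have "\<bar>2 * u t * u' t\<bar> \<le> y t" by (simp add: y_def power2_diff abs_mult)
    moreover have "\<bar>1 - q t\<bar> \<le> 1 + K" using K[OF that] by linarith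
    ultimately have "\<bar>2 * u t * u' t\<bar> * \<bar>1 - q t\<bar> \<le> y t * (1 + K)"
      by (intro mult_mono) (auto simp: y_def)
    then show ?thesis by (simp add: y'_def abs_mult mult.commute)
  qed
  define L where "L = 1 + K"
  note by' = by'[folded L_def]
  have d: "((\<lambda>t. y t * exp (C * t)) has_real_derivative (y' t + C * y t) * exp (C * t)) (at t)"
    if "a < t" "t < b" for t C
    using dy[of t] that by (auto intro!: derivative_eq_intros simp: at_within_Icc_at algebra_simps)
  have y0: "y s0 = 0" using z by (simp add: y_def)
  have "y s \<le> 0"
  proof (cases "s0 \<le> s")
    case True
    have "y s * exp (- L * s) \<le> y s0 * exp (- L * s0)"
    proof (rule DERIV_nonpos_imp_decreasing_open[OF True])
      show "\<exists>l. ((\<lambda>t. y t * exp (- L * t)) has_real_derivative l) (at t) \<and> l \<le> 0"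
        if "s0 < t" "t < s" for t
      proof (intro exI conjI)
        show "(y' t + - L * y t) * exp (- L * t) \<le> 0"
          using abs_le_D1[OF by'[of t]] that z s by (intro mult_nonpos_nonneg) auto
        show "((\<lambda>t. y t * exp (- L * t)) has_real_derivative
          (y' t + - L * y t) * exp (- L * t)) (at t)"
          using that z s by (intro d) auto
      qed
      show "continuous_on {s0..s} (\<lambda>t. y t * exp (- L * t))"
        using cy z s by (auto intro!: continuous_intros intro: continuous_on_subset)
    qed
    then show ?thesis by (simp add: y0 mult_le_0_iff)
  next
    case False
    then have le: "s \<le> s0" by simp
    have "y s * exp (L * s) \<le> y s0 * exp (L * s0)"
    proof (rule DERIV_nonneg_imp_increasing_open[OF le])
      show "\<exists>l. ((\<lambda>t. y t * exp (L * t)) has_real_derivative l) (at t) \<and> l \<ge> 0"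
        if "s < t" "t < s0" for t
      proof (intro exI conjI)
        show "0 \<le> (y' t + L * y t) * exp (L * t)"
          using abs_le_D2[OF by'[of t]] that z s by (intro mult_nonneg_nonneg) auto
        show "((\<lambda>t. y t * exp (L * t)) has_real_derivative
          (y' t + L * y t) * exp (L * t)) (at t)"
          using that z s by (intro d) auto
      qed
      show "continuous_on {s..s0} (\<lambda>t. y t * exp (L * t))"
        using cy z s by (auto intro!: continuous_intros intro: continuous_on_subset)
    qed
    then show ?thesis by (simp add: y0 mult_le_0_iff)
  qed
  then have "(u s)\<^sup>2 + (u' s)\<^sup>2 \<le> 0" by (simp add: y_def)
  then show ?thesis by (simp add: sum_power2_le_zero_iff)
qed

section \<open>Two zeros of a Jacobi field\<close>

lemma C1_extend_by_zero:
  fixes w w' :: "real \<Rightarrow> real"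
  assumes le: "a \<le> c" "c < d" "d \<le> b" and w: "C1_deriv_on {c..d} w w'"
    and z: "w c = 0" "w d = 0" "w' c = 0" "w' d = 0"
  shows "C1_deriv_on {a..b} (\<lambda>s. if s \<in> {c..d} then w s else 0) (\<lambda>s. if s \<in> {c..d} then w' s else 0)"
proof -
  let ?T = "{a..c} \<union> {d..b}"
  have U: "{a..b} = {c..d} \<union> ?T" using le by auto
  have cl: "closure {c..d} \<inter> closure ?T = {c, d}"
    using le by (auto simp: closure_closed)
  have S: "{c..d} \<union> {c, d} = {c..d}" using le by auto
  have "((\<lambda>s. if s \<in> {c..d} then w s else 0) has_vector_derivative (if s \<in> {c..d} then w' s else 0))
          (at s within {a..b})" if s: "s \<in> {a..b}" for s
  proof (rule has_vector_derivative_If_within_closures[where T = ?T and f = w and g = "\<lambda>_. 0" and f' = w' and g' = "\<lambda>_. 0"])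
    show "s \<in> {c..d} \<union> ?T" "{a..b} = {c..d} \<union> ?T" using s U by auto
    show "(w has_vector_derivative w' s) (at s within {c..d} \<union> closure {c..d} \<inter> closure ?T)"
      if "s \<in> {c..d} \<union> closure {c..d} \<inter> closure ?T"
      using that C1_deriv_onD(1)[OF w] unfolding cl S
      by (simp add: has_real_derivative_iff_has_vector_derivative)
    have *: "s \<in> {c, d}" if "s \<in> closure {c..d}" "s \<in> closure ?T"
      using that unfolding cl[symmetric] by blast
    show "w s = 0" "w' s = 0" if "s \<in> closure {c..d}" "s \<in> closure ?T"
      using *[OF that] z by auto
  qed auto
  moreover have "continuous_on ({c..d} \<union> ?T) (\<lambda>s. if s \<in> {c..d} then w' s else 0)"
    using C1_deriv_onD(2)[OF w] z le by (intro continuous_on_cases) auto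
  ultimately show ?thesis
    unfolding C1_deriv_on_def U[symmetric] has_real_derivative_iff_has_vector_derivative by blast
qed

text \<open>
  The test functions \<open>u H\<close> with \<open>H = u\<^sup>2 / (u\<^sup>2 + e)\<close> on \<open>[c,d]\<close>, extended by zero, have form values tending
  to \<open>0\<close> as \<open>e\<close> decreases to \<open>0\<close>, while \<open>\<integral> (u H)\<^sup>2\<close> increases. So coercivity forces this integral to vanish.
\<close>

lemma two_zeros_not_coercive:
  fixes u u' q :: "real \<Rightarrow> real"
  assumes le: "a \<le> c" "c < d" "d \<le> b"
    and u: "\<And>s. s \<in> {a..b} \<Longrightarrow> (u has_real_derivative u' s) (at s within {a..b})"
    and u': "\<And>s. s \<in> {a..b} \<Longrightarrow> (u' has_real_derivative - (q s * u s)) (at s within {a..b})"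
    and z: "u c = 0" "u d = 0" and k: "k > 0"
    and coercive: "\<And>\<tau> h. C1_deriv_on {a..b} \<tau> h \<Longrightarrow> \<tau> a = 0 \<Longrightarrow> \<tau> b = 0 \<Longrightarrow>
        k * integral {a..b} (\<lambda>s. (\<tau> s)\<^sup>2) \<le> integral {a..b} (\<lambda>s. (h s)\<^sup>2 - q s * (\<tau> s)\<^sup>2)"
    and s: "s \<in> {c..d}"
  shows "u s = 0"
proof -
  have sub: "{c..d} \<subseteq> {a..b}" using le by auto
  have u_cd: "(u has_real_derivative u' s) (at s within {c..d})" if "s \<in> {c..d}" for s
    using has_field_derivative_subset[OF u sub] that sub by blast
  have u'_cd: "(u' has_real_derivative - (q s * u s)) (at s within {c..d})" if "s \<in> {c..d}" for s
    using has_field_derivative_subset[OF u' sub] that sub by blast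
  have [continuous_intros]: "continuous_on {c..d} u" "continuous_on {c..d} u'"
    using DERIV_continuous_on[of "{c..d}", OF u_cd] DERIV_continuous_on[of "{c..d}", OF u'_cd] by simp_all
  define e where "e = (\<lambda>n. inverse (real (Suc n)))"
  have e: "0 < e n" "e n \<le> e 0" for n by (auto simp: e_def intro!: inverse_le_1_iff[THEN iffD2])
  have pos: "0 < (u s)\<^sup>2 + e n" for n s
    using e(1)[of n] by (simp add: add_nonneg_pos)
  \<comment> \<open>\<open>u H\<close> vanishes to third order in \<open>u\<close>, hence extends by zero to a \<open>C\<^sup>1\<close> function.\<close>
  define H where "H = (\<lambda>n s. (u s)\<^sup>2 / ((u s)\<^sup>2 + e n))"
  define H' where "H' = (\<lambda>n s. 2 * e n * u s * u' s / ((u s)\<^sup>2 + e n)\<^sup>2)"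
  define W where "W = (\<lambda>n s. u s * H n s)"
  define W' where "W' = (\<lambda>n s. u' s * H n s + u s * H' n s)"
  have ne: "(u s)\<^sup>2 + e n \<noteq> 0" for n s using pos[of s n] by simp
  have H: "C1_deriv_on {c..d} (H n) (H' n)" for n
    unfolding C1_deriv_on_def
  proof (intro conjI ballI)
    show "(H n has_real_derivative H' n s) (at s within {c..d})" if "s \<in> {c..d}" for s
      unfolding H_def H'_def using ne[of s n]
      by (auto intro!: derivative_eq_intros u_cd[OF that] simp: field_simps power2_eq_square)
    show "continuous_on {c..d} (H' n)"
      unfolding H'_def using ne by (auto intro!: continuous_intros)
  qed
  note [continuous_intros] = C1_deriv_onD(2,3)[OF H]
  have W: "C1_deriv_on {c..d} (W n) (W' n)" for n
    unfolding C1_deriv_on_def W_def W'_def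
    by (auto intro!: continuous_intros derivative_eq_intros u_cd C1_deriv_onD(1)[OF H])
  have Q: "k * integral {c..d} (\<lambda>s. (W n s)\<^sup>2) \<le> integral {c..d} (\<lambda>s. (u s * H' n s)\<^sup>2)" for n
  proof -
    let ?\<tau> = "\<lambda>s. if s \<in> {c..d} then W n s else 0" and ?h = "\<lambda>s. if s \<in> {c..d} then W' n s else 0"
    have "C1_deriv_on {a..b} ?\<tau> ?h"
      by (rule C1_extend_by_zero[OF le W]) (auto simp: W_def W'_def H_def H'_def z)
    moreover have "?\<tau> a = 0" "?\<tau> b = 0" using le z by (auto simp: W_def)
    ultimately have "k * integral {a..b} (\<lambda>s. (?\<tau> s)\<^sup>2) \<le> integral {a..b} (\<lambda>s. (?h s)\<^sup>2 - q s * (?\<tau> s)\<^sup>2)"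
      by (rule coercive)
    moreover have "(\<lambda>s. (?\<tau> s)\<^sup>2) = (\<lambda>s. if s \<in> {c..d} then (W n s)\<^sup>2 else 0)"
      and "(\<lambda>s. (?h s)\<^sup>2 - q s * (?\<tau> s)\<^sup>2) = (\<lambda>s. if s \<in> {c..d} then (W' n s)\<^sup>2 - q s * (W n s)\<^sup>2 else 0)"
      by auto
    moreover have "{c..d} \<inter> {a..b} = {c..d}" using sub by blast
    ultimately have "k * integral {c..d} (\<lambda>s. (W n s)\<^sup>2) \<le> integral {c..d} (\<lambda>s. (W' n s)\<^sup>2 - q s * (W n s)\<^sup>2)"
      by (simp only: Henstock_Kurzweil_Integration.integral_restrict_Int)
    also have "\<dots> = integral {c..d} (\<lambda>s. (u s * H' n s)\<^sup>2)"
      unfolding W_def W'_def using le z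
      by (intro integral_unique Jacobi_identity u_cd u'_cd H) auto
    finally show ?thesis .
  qed
  have mono: "(W 0 s)\<^sup>2 \<le> (W n s)\<^sup>2" for n s
  proof -
    have "H 0 s \<le> H n s"
      unfolding H_def using e(2)[of n] pos[of s n] by (intro frac_le) auto
    moreover have "0 \<le> H 0 s" unfolding H_def using pos[of s 0] by simp
    ultimately show ?thesis unfolding W_def power_mult_distrib
      by (intro mult_left_mono power_mono) auto
  qed
  have Q0: "k * integral {c..d} (\<lambda>s. (W 0 s)\<^sup>2) \<le> integral {c..d} (\<lambda>s. (u s * H' n s)\<^sup>2)" for n
  proof -
    have "integral {c..d} (\<lambda>s. (W 0 s)\<^sup>2) \<le> integral {c..d} (\<lambda>s. (W n s)\<^sup>2)"
      using mono C1_deriv_onD(3)[OF W]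
      by (intro integral_le integrable_continuous_interval continuous_intros) auto
    then show ?thesis using Q[of n] k by (meson mult_left_mono order_trans less_imp_le)
  qed
  have "(\<lambda>n. integral {c..d} (\<lambda>s. (u s * H' n s)\<^sup>2)) \<longlonglongrightarrow> integral {c..d} (\<lambda>s. 0)"
  proof (rule dominated_convergence(2))
    show "(\<lambda>s. (u s * H' n s)\<^sup>2) integrable_on {c..d}" for n
      by (intro integrable_continuous_interval continuous_intros)
    show "(\<lambda>s. (u' s)\<^sup>2) integrable_on {c..d}"
      by (intro integrable_continuous_interval continuous_intros)
    show "norm ((u s * H' n s)\<^sup>2) \<le> (u' s)\<^sup>2" for n s
    proof -
      \<comment> \<open>\<open>u H' = r u'\<close> with \<open>0 \<le> r \<le> 1\<close>, because \<open>2 e u\<^sup>2 \<le> (u\<^sup>2 + e)\<^sup>2\<close>.\<close>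
      define r where "r = 2 * e n * (u s)\<^sup>2 / ((u s)\<^sup>2 + e n)\<^sup>2"
      have "2 * e n * (u s)\<^sup>2 \<le> ((u s)\<^sup>2 + e n)\<^sup>2"
        by (simp add: power2_sum mult.commute mult.left_commute)
      then have "0 \<le> r" "r \<le> 1" using pos[of s n] e(1)[of n] by (auto simp: r_def)
      then have "r\<^sup>2 * (u' s)\<^sup>2 \<le> 1 * (u' s)\<^sup>2"
        by (intro mult_right_mono) (auto simp: power_le_one)
      moreover have "u s * H' n s = r * u' s" by (simp add: r_def H'_def power2_eq_square)
      ultimately show ?thesis by (simp add: power_mult_distrib)
    qed
    show "(\<lambda>n. (u s * H' n s)\<^sup>2) \<longlonglongrightarrow> 0" for s
    proof (cases "u s = 0")
      case False
      have "e \<longlonglongrightarrow> 0" unfolding e_def by (rule LIMSEQ_inverse_real_of_nat)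
      then have "(\<lambda>n. (u s * H' n s)\<^sup>2) \<longlonglongrightarrow> (u s * (2 * 0 * u s * u' s / ((u s)\<^sup>2 + 0)\<^sup>2))\<^sup>2"
        unfolding H'_def using False by (intro tendsto_intros) auto
      then show ?thesis by simp
    qed simp
  qed
  then have "k * integral {c..d} (\<lambda>s. (W 0 s)\<^sup>2) \<le> 0"
    using Q0 by (intro LIMSEQ_le_const) auto
  then have "integral {c..d} (\<lambda>s. (W 0 s)\<^sup>2) \<le> 0" using k by (simp add: mult_le_0_iff)
  moreover have "0 \<le> integral {c..d} (\<lambda>s. (W 0 s)\<^sup>2)"
    using C1_deriv_onD(3)[OF W]
    by (intro integral_nonneg integrable_continuous_interval continuous_intros) auto
  moreover have "continuous_on {c..d} (\<lambda>s. (W 0 s)\<^sup>2)"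
    using C1_deriv_onD(3)[OF W] by (intro continuous_intros) auto
  ultimately have "W 0 s = 0"
    using integral_eq_0_iff[of c d "\<lambda>s. (W 0 s)\<^sup>2"] le(2) s by simp
  then show ?thesis using ne[of s 0] by (auto simp: W_def H_def)
qed

section \<open>Approximation by perturbations of class C2\<close>

lemma C2_approximation:
  fixes \<tau> h :: "real \<Rightarrow> real"
  assumes ab: "a < b" and \<tau>: "C1_deriv_on {a..b} \<tau> h" and bd: "\<tau> a = 0" "\<tau> b = 0"
  obtains \<sigma> p where "\<And>n. Ck_on 2 {a..b} (\<sigma> n)" "\<And>n. C1_deriv_on {a..b} (\<sigma> n) (p n)"
    "\<And>n. \<sigma> n a = 0" "\<And>n. \<sigma> n b = 0"
    "uniform_limit {a..b} p h sequentially" "uniform_limit {a..b} \<sigma> \<tau> sequentially"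
proof -
  have ch: "continuous_on {a..b} h" using C1_deriv_onD(2)[OF \<tau>] .
  have FTC: "integral {a..s} h = \<tau> s" if "s \<in> {a..b}" for s
  proof -
    have "(\<tau> has_real_derivative h t) (at t within {a..s})" if "t \<in> {a..s}" for t
      using that \<open>s \<in> _\<close> by (intro has_field_derivative_subset[OF C1_deriv_onD(1)[OF \<tau>]]) auto
    then have "(h has_integral (\<tau> s - \<tau> a)) {a..s}" using that
      by (intro fundamental_theorem_of_calculus)
        (auto simp: has_real_derivative_iff_has_vector_derivative[symmetric])
    then show ?thesis using bd by (simp add: integral_unique)
  qed
  obtain P where P: "uniform_limit {a..b} P h sequentially" "\<And>n. polynomial_function (P n :: real \<Rightarrow> real)"
    using Stone_Weierstrass_uniform_limit[OF compact_Icc ch] by blast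
  have "\<forall>n. \<exists>p'. real_polynomial_function p' \<and> (\<forall>x. (P n has_real_derivative p' x) (at x))"
    using P(2) has_real_derivative_polynomial_function by (metis real_polynomial_function_eq)
  then obtain P' where P': "\<And>n. real_polynomial_function (P' n)" "\<And>n x. (P n has_real_derivative P' n x) (at x)"
    by metis
  have cP: "continuous_on {a..b} (P n)" for n
    using P(2) by (rule continuous_on_polymonial_function)
  have cP': "continuous_on {a..b} (P' n)" for n
    using P'(1) continuous_on_polymonial_function real_polynomial_function_eq by blast
  \<comment> \<open>Subtracting the mean makes the primitive of \<open>P n\<close> vanish at \<open>b\<close> as well.\<close>
  define c where "c = (\<lambda>n. integral {a..b} (P n) / (b - a))"
  define p where "p = (\<lambda>n s. P n s - c n)"
  define \<sigma> where "\<sigma> = (\<lambda>n s. integral {a..s} (p n))"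
  have "c \<longlonglongrightarrow> 0"
  proof -
    obtain I J where I: "\<And>n. (P n has_integral I n) {a..b}" "(h has_integral J) {a..b}" "I \<longlonglongrightarrow> J"
      using uniform_limit_integral[OF P(1) cP] by auto
    then have "(\<lambda>n. integral {a..b} (P n)) \<longlonglongrightarrow> integral {a..b} h"
      by (simp add: integral_unique[OF I(1)] integral_unique[OF I(2)])
    then have "c \<longlonglongrightarrow> integral {a..b} h / (b - a)"
      unfolding c_def using ab by (intro tendsto_intros) auto
    then show ?thesis using FTC[of b] ab bd by simp
  qed
  then have "uniform_limit {a..b} (\<lambda>n s. c n) (\<lambda>s. 0) sequentially"
    by (auto simp: tendsto_iff uniform_limit_iff)
  from uniform_limit_minus[OF P(1) this] have up: "uniform_limit {a..b} p h sequentially"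
    by (simp add: p_def)
  have cp: "continuous_on {a..b} (p n)" for n
    unfolding p_def using cP by (intro continuous_intros)
  have dp: "C1_deriv_on {a..b} (p n) (P' n)" for n
    unfolding C1_deriv_on_def p_def using cP'
    by (auto intro!: derivative_eq_intros has_field_derivative_at_within[OF P'(2)])
  have d\<sigma>: "C1_deriv_on {a..b} (\<sigma> n) (p n)" for n
    unfolding C1_deriv_on_def \<sigma>_def using cp by (auto intro!: integral_has_real_derivative)
  have "uniform_limit {a..b} \<sigma> \<tau> sequentially"
  proof (rule uniform_limitI)
    fix \<epsilon> :: real assume \<epsilon>: "\<epsilon> > 0"
    define \<delta> where "\<delta> = \<epsilon> / (2 * (b - a))"
    have \<delta>: "\<delta> > 0" using \<epsilon> ab by (simp add: \<delta>_def)
    have "\<forall>\<^sub>F n in sequentially. \<forall>x\<in>{a..b}. dist (p n x) (h x) < \<delta>"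
      using uniform_limitD[OF up \<delta>] .
    then show "\<forall>\<^sub>F n in sequentially. \<forall>x\<in>{a..b}. dist (\<sigma> n x) (\<tau> x) < \<epsilon>"
    proof (rule eventually_mono, intro ballI)
      fix n s assume n: "\<forall>x\<in>{a..b}. dist (p n x) (h x) < \<delta>" and s: "s \<in> {a..b}"
      have sub: "{a..s} \<subseteq> {a..b}" using s by auto
      have "\<sigma> n s - \<tau> s = integral {a..s} (\<lambda>t. p n t - h t)"
        unfolding \<sigma>_def FTC[OF s, symmetric]
        using continuous_on_subset[OF ch sub] continuous_on_subset[OF cp sub]
        by (intro integral_diff[symmetric] integrable_continuous_interval) auto
      also have "norm \<dots> \<le> \<delta> * (s - a)"
      proof (rule integral_bound)
        show "continuous_on {a..s} (\<lambda>t. p n t - h t)"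
          using continuous_on_subset[OF cp sub] continuous_on_subset[OF ch sub] by (intro continuous_intros)
        show "norm (p n t - h t) \<le> \<delta>" if "t \<in> {a..s}" for t
          using n sub that by (auto simp: dist_norm intro: less_imp_le)
      qed (use s in auto)
      also have "\<dots> \<le> \<delta> * (b - a)" using s \<delta> by (intro mult_left_mono) auto
      also have "\<dots> = \<epsilon> / 2"
        unfolding \<delta>_def times_divide_eq_left using ab by (subst nonzero_divide_eq_eq) auto
      also have "\<dots> < \<epsilon>" using \<epsilon> by simp
      finally show "dist (\<sigma> n s) (\<tau> s) < \<epsilon>" by (simp add: dist_norm)
    qed
  qed
  moreover have "Ck_on 2 {a..b} (\<sigma> n)" for n
    unfolding Ck_on_2_iff using dp C1_deriv_onD(1)[OF d\<sigma>] by blast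
  moreover have "\<sigma> n a = 0" for n by (simp add: \<sigma>_def)
  moreover have "\<sigma> n b = 0" for n
    using ab cP[of n] by (simp add: \<sigma>_def p_def c_def integral_diff integrable_continuous_interval)
  ultimately show thesis using that d\<sigma> up by blast
qed

text \<open>
  Negativity of the form passes from a \<open>C\<^sup>1\<close> perturbation to a \<open>C\<^sup>2\<close> one, since the form is continuous
  under uniform convergence of a function and its derivative.
\<close>

lemma C2_perturbation_negative_form:
  fixes \<tau> h q :: "real \<Rightarrow> real"
  assumes ab: "a < b" and \<tau>: "C1_deriv_on {a..b} \<tau> h" "\<tau> a = 0" "\<tau> b = 0"
    and q: "continuous_on {a..b} q"
    and neg: "integral {a..b} (\<lambda>s. (h s)\<^sup>2 - q s * (\<tau> s)\<^sup>2) < 0"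
  obtains \<sigma> p where "\<sigma> \<in> D_D a b" "C1_deriv_on {a..b} \<sigma> p"
    "integral {a..b} (\<lambda>s. (p s)\<^sup>2 - q s * (\<sigma> s)\<^sup>2) < 0"
proof -
  obtain \<sigma> p where \<sigma>: "\<And>n. Ck_on 2 {a..b} (\<sigma> n)" "\<And>n. C1_deriv_on {a..b} (\<sigma> n) (p n)"
    "\<And>n. \<sigma> n a = 0" "\<And>n. \<sigma> n b = 0"
    and lim: "uniform_limit {a..b} p h sequentially" "uniform_limit {a..b} \<sigma> \<tau> sequentially"
    using C2_approximation[OF ab \<tau>] by metis
  note c = C1_deriv_onD(2,3)[OF \<tau>(1)] C1_deriv_onD(2,3)[OF \<sigma>(2)]
  have bdd: "bounded (f ` {a..b})" if "continuous_on {a..b} f" for f :: "real \<Rightarrow> real"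
    using compact_imp_bounded compact_continuous_image that compact_Icc by blast
  have ul: "uniform_limit {a..b} (\<lambda>n s. p n s * p n s - q s * (\<sigma> n s * \<sigma> n s))
      (\<lambda>s. h s * h s - q s * (\<tau> s * \<tau> s)) sequentially"
    using c q lim
    by (intro uniform_limit_minus uniform_lim_mult bdd continuous_intros)
      (auto intro: uniform_limit_const simp: uniform_limit_iff)
  have cont: "continuous_on {a..b} (\<lambda>s. p n s * p n s - q s * (\<sigma> n s * \<sigma> n s))" for n
    using c q by (intro continuous_intros)
  obtain I J where I: "\<And>n. ((\<lambda>s. p n s * p n s - q s * (\<sigma> n s * \<sigma> n s)) has_integral I n) {a..b}"
     "((\<lambda>s. h s * h s - q s * (\<tau> s * \<tau> s)) has_integral J) {a..b}" "I \<longlonglongrightarrow> J"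
    using uniform_limit_integral[OF ul cont sequentially_bot] by blast
  then have "(\<lambda>n. integral {a..b} (\<lambda>s. (p n s)\<^sup>2 - q s * (\<sigma> n s)\<^sup>2)) \<longlonglongrightarrow>
      integral {a..b} (\<lambda>s. (h s)\<^sup>2 - q s * (\<tau> s)\<^sup>2)"
    by (simp add: integral_unique[OF I(1)] integral_unique[OF I(2)] power2_eq_square)
  from order_tendstoD(2)[OF this neg] obtain n
    where n: "integral {a..b} (\<lambda>s. (p n s)\<^sup>2 - q s * (\<sigma> n s)\<^sup>2) < 0"
    using eventually_happens'[OF sequentially_bot] by blast
  have "\<exists>s\<in>{a..b}. \<sigma> n s \<noteq> 0"
  proof (rule ccontr)
    assume "\<not> ?thesis"
    then have z: "\<sigma> n s = 0" if "s \<in> {a..b}" for s using that by blast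
    then have "integral {a..b} (\<lambda>s. (p n s)\<^sup>2 - q s * (\<sigma> n s)\<^sup>2) = integral {a..b} (\<lambda>s. 0)"
      using C1_deriv_on_zero[OF ab \<sigma>(2) z] by (intro integral_cong) auto
    with n show False by simp
  qed
  then have "\<sigma> n \<in> D_D a b" using \<sigma> by (auto simp: D_D_def)
  then show thesis using that \<sigma>(2) n by blast
qed

section \<open>Critical points of the energy\<close>

text \<open>
  A function \<open>\<theta>\<close> of class \<open>C\<^sup>1\<close> with derivative \<open>u\<close> at which the first variation of the energy vanishes, for a
  potential \<open>V\<close> with derivatives \<open>V1\<close> and \<open>V2\<close>. The first variation is written out as an integral, and
  \<open>\<tau> = 0\<close> is allowed as a perturbation.
\<close>

locale critical_point =
  fixes a b A :: real and V V1 V2 \<theta> u :: "real \<Rightarrow> real"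
  assumes ab: "a < b"
    and V: "\<And>x. (V has_real_derivative V1 x) (at x)"
    and V1: "\<And>x. (V1 has_real_derivative V2 x) (at x)"
    and V2: "continuous_on UNIV V2"
    and \<theta>: "C1_deriv_on {a..b} \<theta> u"
    and first_variation: "\<And>\<tau> h. C1_deriv_on {a..b} \<tau> h \<Longrightarrow> \<tau> a = 0 \<Longrightarrow> \<tau> b = 0 \<Longrightarrow>
        integral {a..b} (\<lambda>s. (u s - A) * h s - V1 (\<theta> s) * \<tau> s) = 0"
begin

text \<open>The coefficient of the Jacobi equation along \<open>\<theta>\<close>.\<close>

abbreviation q :: "real \<Rightarrow> real" where "q s \<equiv> V2 (\<theta> s)"

lemma continuous_on_V1: "continuous_on UNIV V1"
  by (intro continuous_at_imp_continuous_on ballI DERIV_isCont[OF V1])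

lemma continuous_on_q: "continuous_on {a..b} q"
  by (rule continuous_on_compose2[OF V2 C1_deriv_onD(3)[OF \<theta>]]) simp

lemma Euler_Lagrange:
  assumes "s \<in> {a..b}"
  shows "(u has_real_derivative - V1 (\<theta> s)) (at s within {a..b})"
proof -
  have "\<forall>s\<in>{a..b}. ((\<lambda>s. u s - A) has_real_derivative - V1 (\<theta> s)) (at s within {a..b})"
  proof (rule du_Bois_Reymond[OF ab])
    show "continuous_on {a..b} (\<lambda>s. u s - A)"
      using C1_deriv_onD(2)[OF \<theta>] by (intro continuous_intros)
    show "continuous_on {a..b} (\<lambda>s. V1 (\<theta> s))"
      by (rule continuous_on_compose2[OF continuous_on_V1 C1_deriv_onD(3)[OF \<theta>]]) simp
  qed (rule first_variation)
  then have "((\<lambda>s. (u s - A) + A) has_real_derivative - V1 (\<theta> s) + 0) (at s within {a..b})"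
    using assms by (intro DERIV_add DERIV_const) auto
  then show ?thesis by simp
qed

lemma Jacobi_equation:
  assumes "s \<in> {a..b}"
  shows "((\<lambda>s. - V1 (\<theta> s)) has_real_derivative - (q s * u s)) (at s within {a..b})"
  by (intro DERIV_minus DERIV_chain2[OF V1 C1_deriv_onD(1)[OF \<theta> assms]])

lemma second_variation_eq:
  assumes "C1_deriv_on {a..b} \<tau> h"
  shows "second_variation a b A V \<theta> \<tau> = integral {a..b} (\<lambda>s. (h s)\<^sup>2 - q s * (\<tau> s)\<^sup>2)"
proof -
  have "deriv (\<lambda>\<epsilon>. energy a b A V (\<lambda>s. \<theta> s + \<epsilon> * \<tau> s)) =
      (\<lambda>\<epsilon>. integral {a..b} (\<lambda>s. (u s + \<epsilon> * h s - A) * h s - V1 (\<theta> s + \<epsilon> * \<tau> s) * \<tau> s))"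
    by (rule ext, rule DERIV_imp_deriv, rule energy_has_derivative[OF ab V continuous_on_V1 \<theta> assms])
  then show ?thesis
    unfolding second_variation_def
    using DERIV_imp_deriv[OF energy_has_second_derivative[OF V1 V2 \<theta> assms, where \<epsilon> = 0]] by simp
qed

lemma strict_min_along:
  assumes \<tau>: "C1_deriv_on {a..b} \<tau> h" "\<tau> a = 0" "\<tau> b = 0"
    and pos: "integral {a..b} (\<lambda>s. (h s)\<^sup>2 - q s * (\<tau> s)\<^sup>2) > 0"
  shows "\<exists>M>0. \<forall>\<epsilon>\<in>{-M..M} - {0}. energy a b A V (\<lambda>s. \<theta> s + \<epsilon> * \<tau> s) > energy a b A V \<theta>"
  using strict_local_min_second_derivative[OF energy_has_derivative[OF ab V continuous_on_V1 \<theta> \<tau>(1), where A = A] _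
      energy_has_second_derivative[OF V1 V2 \<theta> \<tau>(1), where \<epsilon> = 0]] first_variation[OF \<tau>] pos
  by simp

lemma strict_max_along:
  assumes \<tau>: "C1_deriv_on {a..b} \<tau> h" "\<tau> a = 0" "\<tau> b = 0"
    and neg: "integral {a..b} (\<lambda>s. (h s)\<^sup>2 - q s * (\<tau> s)\<^sup>2) < 0"
  shows "\<exists>M>0. \<forall>\<epsilon>\<in>{-M..M} - {0}. energy a b A V (\<lambda>s. \<theta> s + \<epsilon> * \<tau> s) < energy a b A V \<theta>"
  using strict_local_min_second_derivative[OF
      DERIV_minus[OF energy_has_derivative[OF ab V continuous_on_V1 \<theta> \<tau>(1), where A = A]] _
      DERIV_minus[OF energy_has_second_derivative[OF V1 V2 \<theta> \<tau>(1), where \<epsilon> = 0]]]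
    first_variation[OF \<tau>] neg
  by simp

lemma not_locally_minimal:
  assumes \<tau>: "C1_deriv_on {a..b} \<tau> h" "\<tau> a = 0" "\<tau> b = 0"
    and neg: "integral {a..b} (\<lambda>s. (h s)\<^sup>2 - q s * (\<tau> s)\<^sup>2) < 0"
  shows "\<not> locally_minimal_on a b A V \<theta> (D_D a b)"
proof
  assume min: "locally_minimal_on a b A V \<theta> (D_D a b)"
  obtain \<sigma> p where \<sigma>: "\<sigma> \<in> D_D a b" "C1_deriv_on {a..b} \<sigma> p"
      "integral {a..b} (\<lambda>s. (p s)\<^sup>2 - q s * (\<sigma> s)\<^sup>2) < 0"
    using C2_perturbation_negative_form[OF ab \<tau> continuous_on_q neg] by blast
  then have "\<sigma> a = 0" "\<sigma> b = 0" by (auto simp: D_D_def)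
  from strict_max_along[OF \<sigma>(2) this \<sigma>(3)] obtain M where M: "M > 0"
      "\<And>\<epsilon>. \<epsilon> \<in> {-M..M} - {0} \<Longrightarrow> energy a b A V (\<lambda>s. \<theta> s + \<epsilon> * \<sigma> s) < energy a b A V \<theta>"
    by blast
  from min \<sigma>(1) obtain N where N: "N > 0"
      "\<And>\<epsilon>. \<epsilon> \<in> {-N..N} - {0} \<Longrightarrow> energy a b A V (\<lambda>s. \<theta> s + \<epsilon> * \<sigma> s) > energy a b A V \<theta>"
    unfolding locally_minimal_on_def by blast
  have "min M N \<in> {-M..M} - {0}" "min M N \<in> {-N..N} - {0}" using M(1) N(1) by auto
  from M(2)[OF this(1)] N(2)[OF this(2)] show False by simp
qed

lemma two_zeros_no_coercivity:
  assumes nontrivial: "\<exists>s\<in>{a..b}. u s \<noteq> 0"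
    and cd: "a \<le> c" "c < d" "d \<le> b" "u c = 0" "u d = 0" and k: "k > 0"
  obtains \<tau> h where "C1_deriv_on {a..b} \<tau> h" "\<tau> a = 0" "\<tau> b = 0"
    "integral {a..b} (\<lambda>s. (h s)\<^sup>2 - q s * (\<tau> s)\<^sup>2) < k * integral {a..b} (\<lambda>s. (\<tau> s)\<^sup>2)"
proof (rule ccontr)
  assume no: "\<not> thesis"
  note witness = that
  have coercive: "k * integral {a..b} (\<lambda>s. (\<tau> s)\<^sup>2) \<le> integral {a..b} (\<lambda>s. (h s)\<^sup>2 - q s * (\<tau> s)\<^sup>2)"
    if "C1_deriv_on {a..b} \<tau> h" "\<tau> a = 0" "\<tau> b = 0" for \<tau> h
    using witness[OF that] no not_le by blast
  have z: "u s = 0" if "s \<in> {c..d}" for s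
    using two_zeros_not_coercive[OF cd(1-3) Euler_Lagrange Jacobi_equation cd(4,5) k coercive that] .
  have sub: "{c..d} \<subseteq> {a..b}" using cd by auto
  have "continuous_on {a..b} (\<lambda>s. - V1 (\<theta> s))"
    using Jacobi_equation by (rule DERIV_continuous_on)
  then have "C1_deriv_on {c..d} u (\<lambda>s. - V1 (\<theta> s))"
    unfolding C1_deriv_on_def using has_field_derivative_subset[OF Euler_Lagrange sub] sub
    by (auto intro: continuous_on_subset)
  then have "- V1 (\<theta> c) = 0"
    by (rule C1_deriv_on_zero[OF cd(2)]) (use z cd in auto)
  then have "u s = 0" if "s \<in> {a..b}" for s
    using linear_ode_unique[OF Euler_Lagrange Jacobi_equation continuous_on_q _ cd(4) _ that] cd by auto
  with nontrivial show False by blast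
qed

text \<open>
  Every perturbation \<open>\<tau>\<close> is \<open>u\<close> times the \<open>C\<^sup>1\<close> function \<open>\<tau> / u\<close>.
\<close>

lemma no_zeros_form_nonneg:
  assumes nz: "\<And>s. s \<in> {a..b} \<Longrightarrow> u s \<noteq> 0"
    and \<tau>: "C1_deriv_on {a..b} \<tau> h" "\<tau> a = 0" "\<tau> b = 0"
  shows "integral {a..b} (\<lambda>s. (h s)\<^sup>2 - q s * (\<tau> s)\<^sup>2) \<ge> 0"
proof -
  let ?v = "\<lambda>s. - V1 (\<theta> s)"
  define H where "H = (\<lambda>s. \<tau> s / u s)"
  define H' where "H' = (\<lambda>s. (h s * u s - \<tau> s * ?v s) / (u s)\<^sup>2)"
  have c: "continuous_on {a..b} u" "continuous_on {a..b} ?v"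
    using DERIV_continuous_on[of "{a..b}", OF Euler_Lagrange]
      DERIV_continuous_on[of "{a..b}", OF Jacobi_equation] by simp_all
  have H: "C1_deriv_on {a..b} H H'"
    unfolding C1_deriv_on_def
  proof (intro conjI ballI)
    show "(H has_real_derivative H' s) (at s within {a..b})" if "s \<in> {a..b}" for s
      unfolding H_def H'_def power2_eq_square
      by (rule DERIV_divide[OF C1_deriv_onD(1)[OF \<tau>(1) that] Euler_Lagrange[OF that] nz[OF that]])
    show "continuous_on {a..b} H'"
      unfolding H'_def using c(1) c(2)[THEN continuous_on_minus] C1_deriv_onD(2,3)[OF \<tau>(1)] nz by (intro continuous_intros) auto
  qed
  have "((\<lambda>s. (?v s * H s + u s * H' s)\<^sup>2 - q s * (u s * H s)\<^sup>2) has_integral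
      integral {a..b} (\<lambda>s. (u s * H' s)\<^sup>2)) {a..b}"
    using ab \<tau> by (intro Jacobi_identity Euler_Lagrange Jacobi_equation H) (auto simp: H_def)
  then have "integral {a..b} (\<lambda>s. (?v s * H s + u s * H' s)\<^sup>2 - q s * (u s * H s)\<^sup>2) =
      integral {a..b} (\<lambda>s. (u s * H' s)\<^sup>2)"
    by (rule integral_unique)
  moreover have "integral {a..b} (\<lambda>s. (?v s * H s + u s * H' s)\<^sup>2 - q s * (u s * H s)\<^sup>2) =
      integral {a..b} (\<lambda>s. (h s)\<^sup>2 - q s * (\<tau> s)\<^sup>2)"
  proof (rule integral_cong)
    fix s assume "s \<in> {a..b}"
    then have "u s * H s = \<tau> s" "?v s * H s + u s * H' s = h s"
      using nz[of s] by (auto simp: H_def H'_def field_simps power2_eq_square)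
    then show "(?v s * H s + u s * H' s)\<^sup>2 - q s * (u s * H s)\<^sup>2 = (h s)\<^sup>2 - q s * (\<tau> s)\<^sup>2" by simp
  qed
  moreover have "integral {a..b} (\<lambda>s. (u s * H' s)\<^sup>2) \<ge> 0"
    using c C1_deriv_onD(2)[OF H]
    by (intro integral_nonneg integrable_continuous_interval continuous_intros) auto
  ultimately show ?thesis by simp
qed

end

lemma stationary_imp_critical_point:
  assumes ab: "a < b" and V: "\<And>x. (V has_real_derivative V1 x) (at x)"
    and V1: "\<And>x. (V1 has_real_derivative V2 x) (at x)" and V2: "continuous_on UNIV V2"
    and st: "stationary_D a b A V Ta Tb \<theta>" and \<theta>: "C1_deriv_on {a..b} \<theta> u"
  shows "critical_point a b A V V1 V2 \<theta> u"
proof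
  fix \<tau> h assume \<tau>: "C1_deriv_on {a..b} \<tau> h" "\<tau> a = 0" "\<tau> b = 0"
  have cV1: "continuous_on UNIV V1"
    by (intro continuous_at_imp_continuous_on ballI DERIV_isCont[OF V1])
  show "integral {a..b} (\<lambda>s. (u s - A) * h s - V1 (\<theta> s) * \<tau> s) = 0"
  proof (cases "\<exists>s\<in>{a..b}. \<tau> s \<noteq> 0")
    case True
    then have "\<tau> \<in> C_D a b" using \<tau> unfolding C_D_def Ck_on_1_iff by blast
    then have "((\<lambda>\<epsilon>. energy a b A V (\<lambda>s. \<theta> s + \<epsilon> * \<tau> s)) has_real_derivative 0) (at 0)"
      using st unfolding stationary_D_def by blast
    from DERIV_unique[OF this energy_has_derivative[OF ab V cV1 \<theta> \<tau>(1)]] show ?thesis by simp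
  next
    case False
    then have "integral {a..b} (\<lambda>s. (u s - A) * h s - V1 (\<theta> s) * \<tau> s) = integral {a..b} (\<lambda>s. 0)"
      using C1_deriv_on_zero[OF ab \<tau>(1)] by (intro integral_cong) auto
    then show ?thesis by simp
  qed
qed (use assms in auto)

section \<open>Zeros of the velocity and local minimality\<close>

lemma axis_hits_ge_2:
  assumes "axis_hits a b \<gamma> \<ge> 2"
  obtains c d where "a \<le> c" "c < d" "d \<le> b" "snd (\<gamma> c) = 0" "snd (\<gamma> d) = 0"
proof -
  define Z where "Z = {s\<in>{a..b}. snd (\<gamma> s) = 0}"
  have "\<exists>x\<in>Z. \<exists>y\<in>Z. x \<noteq> y"
  proof (rule ccontr)
    assume eq: "\<not> ?thesis"
    then have "Z = {} \<or> (\<exists>x. Z = {x})" by blast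
    then have fin: "finite Z" by auto
    then have "card Z \<le> 1" using eq card_le_Suc0_iff_eq[OF fin] by auto
    with assms fin show False
      unfolding axis_hits_def Let_def Z_def[symmetric] by (simp add: numeral_eq_enat)
  qed
  then obtain x y where "x \<in> Z" "y \<in> Z" "x < y" by (metis linorder_neqE_linordered_idom)
  then show thesis using that[of x y] by (auto simp: Z_def)
qed

lemma axis_hits_eq_0:
  assumes "axis_hits a b \<gamma> = 0" "s \<in> {a..b}"
  shows "snd (\<gamma> s) \<noteq> 0"
proof
  assume "snd (\<gamma> s) = 0"
  moreover have "{s\<in>{a..b}. snd (\<gamma> s) = 0} = {}"
    using assms(1) unfolding axis_hits_def Let_def
    by (auto simp: zero_enat_def split: if_splits)
  ultimately show False using assms(2) by blast
qed

theorem theorem1: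
  fixes a b A Ta Tb :: real
    and V \<theta> :: "real \<Rightarrow> real"
    and \<gamma> :: "real \<Rightarrow> real \<times> real"
  assumes "a < b"
    and "Ck_on 2 UNIV V"
    and "\<not> (\<exists>x. deriv V x = 0 \<and> deriv (deriv V) x = 0)"
    and "stationary_D a b A V Ta Tb \<theta>"
    and "\<exists>s\<in>{a..b}. deriv_ivl a b \<theta> s \<noteq> 0"
    and "(\<exists>k>0. \<forall>\<tau>\<in>C_D a b.
            second_variation a b A V \<theta> \<tau> \<ge> k * integral {a..b} (\<lambda>s. (\<tau> s)\<^sup>2))
         \<or> (\<exists>\<tau>\<in>C_D a b. second_variation a b A V \<theta> \<tau> < 0)"
    and "\<gamma> = phase_trajectory a b \<theta>"
  shows "(axis_hits a b \<gamma> \<ge> 2 \<longrightarrow> \<not> locally_minimal_on a b A V \<theta> (D_D a b))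
       \<and> (axis_hits a b \<gamma> = 0 \<longrightarrow> locally_minimal_on a b A V \<theta> (D_D a b))"
proof -
  obtain V1 V2 where V: "\<And>x. (V has_real_derivative V1 x) (at x)"
      "\<And>x. (V1 has_real_derivative V2 x) (at x)" "continuous_on UNIV V2"
    using assms(2) unfolding Ck_on_2_iff C1_deriv_on_def by auto
  obtain u where u: "C1_deriv_on {a..b} \<theta> u"
    using assms(4) unfolding stationary_D_def Ck_on_1_iff by blast
  interpret critical_point a b A V V1 V2 \<theta> u
    by (rule stationary_imp_critical_point[OF assms(1) V assms(4) u])
  have du: "deriv_ivl a b \<theta> s = u s" if "s \<in> {a..b}" for s
    using deriv_ivl_eq[OF ab that C1_deriv_onD(1)[OF u that]] .
  have \<gamma>: "snd (\<gamma> s) = u s" if "s \<in> {a..b}" for s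
    using du[OF that] by (simp add: assms(7) phase_trajectory_def)
  have C_D: "\<exists>h. C1_deriv_on {a..b} \<tau> h \<and> \<tau> a = 0 \<and> \<tau> b = 0" if "\<tau> \<in> C_D a b" for \<tau>
    using that unfolding C_D_def Ck_on_1_iff by blast
  have C_D_I: "\<tau> \<in> C_D a b \<or> (\<forall>s\<in>{a..b}. \<tau> s = 0)"
    if "C1_deriv_on {a..b} \<tau> h" "\<tau> a = 0" "\<tau> b = 0" for \<tau> h
    using that unfolding C_D_def Ck_on_1_iff by blast
  show ?thesis
  proof (intro conjI impI)
    assume "axis_hits a b \<gamma> \<ge> 2"
    then obtain c d where "a \<le> c" "c < d" "d \<le> b" "snd (\<gamma> c) = 0" "snd (\<gamma> d) = 0"
      by (rule axis_hits_ge_2)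
    then have cd: "a \<le> c" "c < d" "d \<le> b" "u c = 0" "u d = 0" using \<gamma> by auto
    have nontrivial: "\<exists>s\<in>{a..b}. u s \<noteq> 0" using assms(5) du by auto
    have "\<exists>\<tau>\<in>C_D a b. second_variation a b A V \<theta> \<tau> < k * integral {a..b} (\<lambda>s. (\<tau> s)\<^sup>2)"
      if k: "k > 0" for k
    proof -
      obtain \<tau> h where \<tau>: "C1_deriv_on {a..b} \<tau> h" "\<tau> a = 0" "\<tau> b = 0"
        and less: "integral {a..b} (\<lambda>s. (h s)\<^sup>2 - q s * (\<tau> s)\<^sup>2) < k * integral {a..b} (\<lambda>s. (\<tau> s)\<^sup>2)"
        using two_zeros_no_coercivity[OF nontrivial cd k] by blast
      have False if z: "\<forall>s\<in>{a..b}. \<tau> s = 0"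
      proof -
        have "integral {a..b} (\<lambda>s. (h s)\<^sup>2 - q s * (\<tau> s)\<^sup>2) = integral {a..b} (\<lambda>s. 0)"
          using C1_deriv_on_zero[OF ab \<tau>(1)] z by (intro integral_cong) auto
        moreover have "integral {a..b} (\<lambda>s. (\<tau> s)\<^sup>2) = integral {a..b} (\<lambda>s. 0)"
          using z by (intro integral_cong) auto
        ultimately show False using less by simp
      qed
      then have "\<tau> \<in> C_D a b" using C_D_I[OF \<tau>] by blast
      then show ?thesis using less second_variation_eq[OF \<tau>(1)] by (intro bexI[of _ \<tau>]) simp_all
    qed
    then obtain \<tau> where \<tau>: "\<tau> \<in> C_D a b" "second_variation a b A V \<theta> \<tau> < 0"
      using assms(6) by (meson not_less)
    then obtain h where "C1_deriv_on {a..b} \<tau> h" "\<tau> a = 0" "\<tau> b = 0" using C_D by blast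
    then show "\<not> locally_minimal_on a b A V \<theta> (D_D a b)"
      using not_locally_minimal \<tau>(2) second_variation_eq by metis
  next
    assume "axis_hits a b \<gamma> = 0"
    then have nz: "u s \<noteq> 0" if "s \<in> {a..b}" for s
      using axis_hits_eq_0 \<gamma> that by metis
    have "second_variation a b A V \<theta> \<tau> \<ge> 0" if "\<tau> \<in> C_D a b" for \<tau>
      using C_D[OF that] no_zeros_form_nonneg[OF nz] second_variation_eq by metis
    then obtain k where k: "k > 0"
        "\<And>\<tau>. \<tau> \<in> C_D a b \<Longrightarrow> second_variation a b A V \<theta> \<tau> \<ge> k * integral {a..b} (\<lambda>s. (\<tau> s)\<^sup>2)"
      using assms(6) by (meson not_less)
    show "locally_minimal_on a b A V \<theta> (D_D a b)"
      unfolding locally_minimal_on_def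
    proof
      fix \<tau> assume "\<tau> \<in> D_D a b"
      then have \<tau>: "\<tau> \<in> C_D a b" using D_D_subset_C_D by blast
      then obtain h where h: "C1_deriv_on {a..b} \<tau> h" "\<tau> a = 0" "\<tau> b = 0" using C_D by blast
      have cont: "continuous_on {a..b} (\<lambda>s. (\<tau> s)\<^sup>2)"
        using C1_deriv_onD(3)[OF h(1)] by (intro continuous_intros)
      have "integral {a..b} (\<lambda>s. (\<tau> s)\<^sup>2) \<noteq> 0"
        using \<tau> integral_eq_0_iff[OF cont ab] by (auto simp: C_D_def)
      moreover have "integral {a..b} (\<lambda>s. (\<tau> s)\<^sup>2) \<ge> 0"
        using cont by (intro integral_nonneg integrable_continuous_interval) auto
      ultimately have "0 < k * integral {a..b} (\<lambda>s. (\<tau> s)\<^sup>2)" using k(1) by simp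
      also have "\<dots> \<le> integral {a..b} (\<lambda>s. (h s)\<^sup>2 - q s * (\<tau> s)\<^sup>2)"
        using k(2)[OF \<tau>] second_variation_eq[OF h(1)] by simp
      finally show "\<exists>M>0. \<forall>\<epsilon>\<in>{-M..M} - {0}. energy a b A V (\<lambda>s. \<theta> s + \<epsilon> * \<tau> s) > energy a b A V \<theta>"
        by (rule strict_min_along[OF h])
    qed
  qed
qed

end
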